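(* Let $A,B\in\mathcal{M}_2(\mathbb{C})$ be $2\times 2$ complex matrices. Then the following two conditions are equivalent: (i) there exists a finite subset $U\subset\{n\in\mathbb{N}: n\geq 2\}$ such that for every $t\in\mathbb{N}\setminus U$, $\exp(tA+B)=\exp(tA)\exp(B)=\exp(B)\exp(tA)$; (ii) $\exp(A+B)=\exp(A)\exp(B)=\exp(B)\exp(A)$ and the pair $(A,B)$ has property L.
   Context: $\mathbb{N}$ denotes the set of positive integers (so $0\notin\mathbb{N}$), and $\exp$ is the matrix exponential. Property L (Motzkin–Taussky): a pair $(A,B)\in\mathcal{M}_n(\mathbb{C})^2$ has property L if there exist orderings $(\lambda_i)_{i\leq n}$ and $(\mu_i)_{i\leq n}$ of the eigenvalues of $A$ and of $B$ respectively (listed with algebraic multiplicity) such that for all $(x,y)\in\mathbb{C}^2$ the eigenvalues of $xA+yB$, counted with algebraic multiplicity, are $(x\lambda_i+y\mu_i)_{i\leq n}$. *)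

theory Defs
  imports "HOL-Analysis.Analysis" "HOL-Computational_Algebra.Polynomial"
begin

(* The ring structure on the type of square matrices (times, one, power) is the
   componentwise one, so powers are built from the matrix product, and the generic
   exp does not apply. *)

primrec matpow :: "complex^'n^'n \<Rightarrow> nat \<Rightarrow> complex^'n^'n" where
  "matpow A 0 = mat 1"
| "matpow A (Suc k) = A ** matpow A k"

definition matexp :: "complex^'n^'n \<Rightarrow> complex^'n^'n" where
  "matexp A = (\<Sum>k. (1 / fact k) *\<^sub>R matpow A k)"

definition mscale :: "complex \<Rightarrow> complex^'n^'n \<Rightarrow> complex^'n^'n"  (infixr "*\<^sub>M" 75) where
  "c *\<^sub>M A = (\<chi> i j. c * A $ i $ j)"

definition charpoly :: "complex^'n^'n \<Rightarrow> complex poly" where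
  "charpoly A = det (\<chi> i j. (if i = j then [:0, 1:] else 0) - [:A $ i $ j:])"

(* The family l, indexed like the rows of A, lists the eigenvalues of A, each one as often
   as its algebraic multiplicity. The order is 0 at complex numbers that are not eigenvalues. *)

definition lists_eigenvalues :: "('n \<Rightarrow> complex) \<Rightarrow> complex^'n^'n \<Rightarrow> bool" where
  "lists_eigenvalues l A \<longleftrightarrow> (\<forall>z. card {i. l i = z} = order z (charpoly A))"

definition property_L :: "complex^'n^'n \<Rightarrow> complex^'n^'n \<Rightarrow> bool" where
  "property_L A B \<longleftrightarrow>
     (\<exists>l m. lists_eigenvalues l A \<and> lists_eigenvalues m B \<and>
        (\<forall>x y. lists_eigenvalues (\<lambda>i. x * l i + y * m i) (x *\<^sub>M A + y *\<^sub>M B)))"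

end

(* Write M = \<tau> I + M' with M' trace-free, so that M'^2 = s^2 I and
   exp M = e^\<tau> (cosh s I + (sinh s / s) M'). If A and B do not commute, then I, A', B' are linearly
   independent, and comparing coefficients shows that exp (A + B) = exp A exp B = exp B exp A
   forces the numbers s of A, B and A + B to be nonzero multiples i pi k, i pi l, i pi m of i pi.
   Property L says that the quadratic form s^2 of x A + y B is a perfect square. If it is, the
   number of t A + B is i pi (t k + l), which vanishes for at most one t. Conversely, (i) makes the
   integer polynomial k^2 t^2 + N t + l^2 a square for all large t, hence its discriminant is 0. *)

theory Submission
  imports Defs
begin

section \<open>The function sinh s / s and its zeros\<close>

text \<open>Filling the removable singularity with 1 lets one formula for the exponential serve
  distinct and coinciding eigenvalues alike.\<close>

definition shc :: "complex \<Rightarrow> complex" where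
  "shc s = (if s = 0 then 1 else sinh s / s)"

lemma shc_mult: "s * shc s = sinh s"
  by (simp add: shc_def)

text \<open>The zeros of sinh solve exp (2 s) = 1, so they are the integer multiples of i pi; the
  multiple 0 drops out because \<open>shc 0\<close> is 1.\<close>

lemma shc_eq_0_iff: "shc s = 0 \<longleftrightarrow> (\<exists>k::int. k \<noteq> 0 \<and> s = of_real (pi * of_int k) * \<i>)"
proof
  assume "shc s = 0"
  then have "s \<noteq> 0" "sinh s = 0"
    by (auto simp: shc_def split: if_splits)
  then have "exp s = exp (- s)"
    by (simp add: sinh_def)
  then have "exp (2 * s) = 1"
    by (metis add.right_inverse exp_add exp_zero mult_2)
  then obtain n :: int where "Re (2 * s) = 0" "Im (2 * s) = of_int (2 * n) * pi"
    using exp_eq_1 by blast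
  then have "s = of_real (pi * of_int n) * \<i>"
    by (simp add: complex_eq_iff)
  with \<open>s \<noteq> 0\<close> show "\<exists>k::int. k \<noteq> 0 \<and> s = of_real (pi * of_int k) * \<i>"
    by (intro exI[of _ n]) auto
next
  assume "\<exists>k::int. k \<noteq> 0 \<and> s = of_real (pi * of_int k) * \<i>"
  then obtain k :: int where k: "k \<noteq> 0" "s = of_real (pi * of_int k) * \<i>"
    by blast
  have "exp (2 * s) = 1"
    unfolding exp_eq_1 using k by (auto simp: mult.commute)
  then have "exp s * exp s = 1"
    by (metis exp_add mult_2)
  then have "exp s = exp (- s)"
    by (metis exp_minus_inverse exp_not_eq_zero mult_cancel_left)
  then show "shc s = 0"
    using k by (simp add: shc_def sinh_def)
qed

lemma shc_eq_0_sinh: "shc s = 0 \<Longrightarrow> sinh s = 0"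
  by (metis mult_zero_right shc_mult)

lemma shc_eq_0_cosh: "shc s = 0 \<Longrightarrow> cosh s \<noteq> 0"
  using hyperbolic_pythagoras[of s] shc_eq_0_sinh[of s] by auto

section \<open>Trace-free parts and the discriminant form of 2 x 2 matrices\<close>

lemma matrix_2_eq_iff:
  fixes M N :: "'a^2^2"
  shows "M = N \<longleftrightarrow> M $ 1 $ 1 = N $ 1 $ 1 \<and> M $ 1 $ 2 = N $ 1 $ 2 \<and>
                   M $ 2 $ 1 = N $ 2 $ 1 \<and> M $ 2 $ 2 = N $ 2 $ 2"
  by (auto simp: vec_eq_iff forall_2)

lemma matrix_matrix_mult_2: "(M ** N) $ i $ j = M $ i $ 1 * N $ 1 $ j + M $ i $ 2 * N $ 2 $ j"
  for M N :: "'a::semiring_1^2^2"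
  by (simp add: matrix_matrix_mult_def sum_2)

lemma mat_2_nth:
  fixes c :: "'a::zero"
  shows "(mat c :: 'a^2^2) $ 1 $ 1 = c" "(mat c :: 'a^2^2) $ 1 $ 2 = 0"
    "(mat c :: 'a^2^2) $ 2 $ 1 = 0" "(mat c :: 'a^2^2) $ 2 $ 2 = c"
  by (simp_all add: mat_def)

lemma mscale_nth: "(c *\<^sub>M M) $ i $ j = c * M $ i $ j"
  by (simp add: mscale_def)

definition traceless :: "complex^2^2 \<Rightarrow> complex^2^2" where
  "traceless M = M - (trace M / 2) *\<^sub>M mat 1"

text \<open>Polar form of the quadratic form sending \<open>M\<close> to minus the determinant of its trace-free part;
  \<open>tform M M\<close> is the square of half the difference of the eigenvalues.\<close>

definition tform :: "complex^2^2 \<Rightarrow> complex^2^2 \<Rightarrow> complex" where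
  "tform M N = trace (traceless M ** traceless N) / 2"

lemma trace_2: "trace M = M $ 1 $ 1 + M $ 2 $ 2" for M :: "'a::semiring_1^2^2"
  by (simp add: trace_def sum_2)

lemma traceless_nth:
  "traceless M $ 1 $ 1 = (M $ 1 $ 1 - M $ 2 $ 2) / 2"
  "traceless M $ 1 $ 2 = M $ 1 $ 2"
  "traceless M $ 2 $ 1 = M $ 2 $ 1"
  "traceless M $ 2 $ 2 = - ((M $ 1 $ 1 - M $ 2 $ 2) / 2)"
  by (simp_all add: traceless_def mscale_nth mat_2_nth trace_2 field_simps)

lemma tform_2:
  "tform M N = (M $ 1 $ 1 - M $ 2 $ 2) * (N $ 1 $ 1 - N $ 2 $ 2) / 4
             + (M $ 1 $ 2 * N $ 2 $ 1 + M $ 2 $ 1 * N $ 1 $ 2) / 2"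
  by (simp add: tform_def trace_2 matrix_matrix_mult_2 traceless_nth field_simps)

text \<open>Read as a quadratic polynomial in \<open>t\<close>, this is the one whose discriminant
  decides property L.\<close>

lemma tform_scale_add:
  "tform (t *\<^sub>M A + B) (t *\<^sub>M A + B) = t\<^sup>2 * tform A A + 2 * t * tform A B + tform B B"
  by (simp add: tform_2 mscale_nth field_simps power2_eq_square)

lemma tform_scale: "tform (t *\<^sub>M A) (t *\<^sub>M A) = t\<^sup>2 * tform A A"
  by (simp add: tform_2 mscale_nth field_simps power2_eq_square)

lemma traceless_add: "traceless (M + N) = traceless M + traceless N"
  by (simp add: matrix_2_eq_iff traceless_nth field_simps)

lemma trace_add_2: "trace (M + N) = trace M + trace N" for M N :: "complex^2^2"
  by (simp add: trace_2)

section \<open>Closed forms of the powers and of the exponential\<close>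

text \<open>By Cayley-Hamilton the trace-free part squares to \<open>tform M M\<close> times the
  identity. Hence multiplication by \<open>M\<close> preserves the span of the identity and
  \<open>traceless M\<close>, and powers obey a recurrence on two coefficients.\<close>

lemma matpow_2_step:
  assumes "tform M M = s\<^sup>2"
  shows "M ** (p *\<^sub>M mat 1 + q *\<^sub>M traceless M) =
    (trace M / 2 * p + s\<^sup>2 * q) *\<^sub>M mat 1 + (p + trace M / 2 * q) *\<^sub>M traceless M"
  unfolding assms[symmetric]
  by (simp add: matrix_2_eq_iff matrix_matrix_mult_2 mscale_nth mat_2_nth traceless_nth
      tform_2 trace_2 field_simps)

text \<open>The coefficients come from linear interpolation of the k-th power at the eigenvalues
  \<tau> + s and \<tau> - s, which differ as s is nonzero.\<close>

lemma matpow_2: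
  fixes M :: "complex^2^2"
  assumes "tform M M = s\<^sup>2" and "\<tau> = trace M / 2" and "s \<noteq> 0"
  shows "matpow M k = (((\<tau> + s) ^ k + (\<tau> - s) ^ k) / 2) *\<^sub>M mat 1
                    + (((\<tau> + s) ^ k - (\<tau> - s) ^ k) / (2 * s)) *\<^sub>M traceless M"
proof (induction k)
  case 0
  show ?case by (simp add: matrix_2_eq_iff mscale_nth)
next
  case (Suc k)
  let ?x = "(\<tau> + s) ^ k" and ?y = "(\<tau> - s) ^ k"
  have 1: "\<tau> * ((?x + ?y) / 2) + s\<^sup>2 * ((?x - ?y) / (2 * s)) = ((\<tau> + s) ^ Suc k + (\<tau> - s) ^ Suc k) / 2"
    using assms(3) by (simp add: field_simps power2_eq_square)
  have 2: "(?x + ?y) / 2 + \<tau> * ((?x - ?y) / (2 * s)) = ((\<tau> + s) ^ Suc k - (\<tau> - s) ^ Suc k) / (2 * s)"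
    using assms(3) by (simp add: field_simps)
  show ?case
    unfolding matpow.simps Suc matpow_2_step[OF assms(1)] assms(2)[symmetric] 1 2 ..
qed

text \<open>The limiting case s = 0 of the interpolation: the divided difference becomes the
  derivative of the k-th power.\<close>

lemma matpow_2_nilpotent:
  fixes M :: "complex^2^2"
  assumes "tform M M = 0" and "\<tau> = trace M / 2"
  shows "matpow M k = (\<tau> ^ k) *\<^sub>M mat 1 + (of_nat k * \<tau> ^ (k - 1)) *\<^sub>M traceless M"
proof (induction k)
  case 0
  show ?case by (simp add: matrix_2_eq_iff mscale_nth)
next
  case (Suc k)
  have 1: "\<tau> * \<tau> ^ k + 0\<^sup>2 * (of_nat k * \<tau> ^ (k - 1)) = \<tau> ^ Suc k"
    by simp
  \<comment> \<open>At k = 0 the exponent \<open>k - 1\<close> truncates, but its factor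
    \<open>of_nat k\<close> is 0; hence the case split.\<close>
  have 2: "\<tau> ^ k + \<tau> * (of_nat k * \<tau> ^ (k - 1)) = of_nat (Suc k) * \<tau> ^ (Suc k - 1)"
    by (cases k) (simp_all add: field_simps)
  have "tform M M = 0\<^sup>2"
    using assms by simp
  note step = matpow_2_step[OF this]
  show ?case
    unfolding matpow.simps Suc step assms(2)[symmetric] 1 2 ..
qed

lemma bounded_linear_mscale: "bounded_linear (\<lambda>z. z *\<^sub>M (M :: complex^2^2))"
proof -
  have "linear (\<lambda>z. z *\<^sub>M M)"
    by (rule linearI) (simp_all add: matrix_2_eq_iff mscale_nth algebra_simps)
  then show ?thesis
    by (simp add: linear_conv_bounded_linear)
qed

text \<open>Scaling a fixed matrix is bounded linear in the scalar, so it suffices to sum the two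
  coefficient series.\<close>

lemma matexp_eqI:
  fixes M :: "complex^2^2"
  assumes "\<And>k. matpow M k = p k *\<^sub>M P + q k *\<^sub>M Q"
    and "(\<lambda>k. p k /\<^sub>R fact k) sums x" and "(\<lambda>k. q k /\<^sub>R fact k) sums y"
  shows "matexp M = x *\<^sub>M P + y *\<^sub>M Q"
proof -
  have "(\<lambda>k. (p k /\<^sub>R fact k) *\<^sub>M P + (q k /\<^sub>R fact k) *\<^sub>M Q) sums (x *\<^sub>M P + y *\<^sub>M Q)"
    by (intro sums_add bounded_linear.sums[OF bounded_linear_mscale] assms)
  moreover have "(p k /\<^sub>R fact k) *\<^sub>M P + (q k /\<^sub>R fact k) *\<^sub>M Q = (1 / fact k) *\<^sub>R matpow M k" for k
    unfolding assms(1) by (simp add: matrix_2_eq_iff mscale_nth algebra_simps divide_inverse)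
  ultimately show ?thesis
    unfolding matexp_def by (simp add: sums_unique[symmetric])
qed

text \<open>The coefficients of the powers sum to the mean and the divided difference of exp at the
  two eigenvalues, or to value and derivative if these coincide. Since cosh and \<open>shc\<close>
  are even, either square root \<open>s\<close> of \<open>tform M M\<close> will do.\<close>

lemma matexp_2:
  fixes M :: "complex^2^2"
  assumes "tform M M = s\<^sup>2"
  shows "matexp M = (exp (trace M / 2) * cosh s) *\<^sub>M mat 1 + (exp (trace M / 2) * shc s) *\<^sub>M traceless M"
proof (cases "s = 0")
  case False
  define \<tau> where "\<tau> = trace M / 2"
  have p: "(\<lambda>k. (((\<tau> + s) ^ k + (\<tau> - s) ^ k) / 2) /\<^sub>R fact k) sums ((exp (\<tau> + s) + exp (\<tau> - s)) / 2)"
    using sums_divide[OF sums_add[OF exp_converges[of "\<tau> + s"] exp_converges[of "\<tau> - s"]], of 2]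
    by (simp add: scaleR_conv_of_real field_simps)
  have q: "(\<lambda>k. (((\<tau> + s) ^ k - (\<tau> - s) ^ k) / (2 * s)) /\<^sub>R fact k) sums
             ((exp (\<tau> + s) - exp (\<tau> - s)) / (2 * s))"
    using sums_divide[OF sums_diff[OF exp_converges[of "\<tau> + s"] exp_converges[of "\<tau> - s"]], of "2 * s"]
    by (simp add: scaleR_conv_of_real diff_divide_distrib right_diff_distrib)
  have "(exp (\<tau> + s) + exp (\<tau> - s)) / 2 = exp \<tau> * cosh s"
    by (simp add: cosh_def exp_add exp_diff exp_minus field_simps scaleR_conv_of_real)
  moreover have "(exp (\<tau> + s) - exp (\<tau> - s)) / (2 * s) = exp \<tau> * shc s"
    using False by (simp add: shc_def sinh_def exp_add exp_diff exp_minus field_simps scaleR_conv_of_real)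
  ultimately show ?thesis
    using matexp_eqI[OF matpow_2[OF assms \<tau>_def False] p q] by (simp add: \<tau>_def)
next
  case True
  define \<tau> where "\<tau> = trace M / 2"
  have q: "(\<lambda>k. (of_nat k * \<tau> ^ (k - 1)) /\<^sub>R fact k) sums exp \<tau>"
  proof -
    \<comment> \<open>The term at index 0 vanishes; after a shift by one, cancelling against the
      factorial leaves the exponential series.\<close>
    have "(of_nat (Suc k) * \<tau> ^ (Suc k - 1)) /\<^sub>R fact (Suc k) = \<tau> ^ k /\<^sub>R fact k" for k
      by (simp add: scaleR_conv_of_real field_simps del: of_nat_Suc)
    then have "(\<lambda>k. (of_nat (Suc k) * \<tau> ^ (Suc k - 1)) /\<^sub>R fact (Suc k)) sums exp \<tau>"
      using exp_converges[of \<tau>] by (simp only:)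
    from sums_Suc[OF this] show ?thesis
      by simp
  qed
  show ?thesis
    using matexp_eqI[OF matpow_2_nilpotent[OF _ \<tau>_def] exp_converges q] assms True
    by (simp add: \<tau>_def shc_def)
qed


section \<open>Commuting pairs and linear independence\<close>

text \<open>Scalar parts do not affect the commutator, and its entries are, up to constant factors,
  the 2 x 2 minors of the coordinates of the trace-free parts. Commuting thus means linear
  dependence of these parts.\<close>

lemma commute_2_iff:
  fixes M N :: "complex^2^2"
  defines "m \<equiv> traceless M" and "n \<equiv> traceless N"
  shows "M ** N = N ** M \<longleftrightarrow>
    m $ 1 $ 1 * n $ 1 $ 2 = m $ 1 $ 2 * n $ 1 $ 1 \<and>
    m $ 1 $ 1 * n $ 2 $ 1 = m $ 2 $ 1 * n $ 1 $ 1 \<and>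
    m $ 1 $ 2 * n $ 2 $ 1 = m $ 2 $ 1 * n $ 1 $ 2"
  unfolding m_def n_def
  by (simp add: matrix_2_eq_iff matrix_matrix_mult_2 traceless_nth field_simps) (auto simp: algebra_simps; algebra)

lemma traceless_traceless [simp]: "traceless (traceless M) = traceless M"
  by (simp add: matrix_2_eq_iff traceless_nth)

lemma commute_traceless_iff:
  "traceless M ** traceless N = traceless N ** traceless M \<longleftrightarrow> M ** N = N ** M"
  by (simp add: commute_2_iff)

text \<open>All minors vanish, so any nonzero coordinate of \<open>traceless M\<close> serves as
  pivot for the ratio \<open>c\<close>.\<close>

lemma commute_2_proportional:
  assumes "M ** N = N ** M"
  shows "traceless M = 0 \<or> (\<exists>c. traceless N = c *\<^sub>M traceless M)"
proof -
  note c = assms[unfolded commute_2_iff]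
  have t: "traceless X $ 2 $ 2 = - traceless X $ 1 $ 1" for X
    by (simp add: traceless_nth)
  consider "traceless M = 0" | "traceless M $ 1 $ 1 \<noteq> 0" | "traceless M $ 1 $ 2 \<noteq> 0" | "traceless M $ 2 $ 1 \<noteq> 0"
    by (auto simp: matrix_2_eq_iff t)
  then show ?thesis
  proof cases
    case 2
    then have "traceless N = (traceless N $ 1 $ 1 / traceless M $ 1 $ 1) *\<^sub>M traceless M"
      using c by (simp add: matrix_2_eq_iff mscale_nth t field_simps)
    then show ?thesis by blast
  next
    case 3
    then have "traceless N = (traceless N $ 1 $ 2 / traceless M $ 1 $ 2) *\<^sub>M traceless M"
      using c by (simp add: matrix_2_eq_iff mscale_nth t field_simps)
    then show ?thesis by blast
  next
    case 4
    then have "traceless N = (traceless N $ 2 $ 1 / traceless M $ 2 $ 1) *\<^sub>M traceless M"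
      using c by (simp add: matrix_2_eq_iff mscale_nth t field_simps)
    then show ?thesis by blast
  qed simp
qed

text \<open>The equality case of Cauchy-Schwarz for proportional vectors; it yields property L for
  commuting pairs.\<close>

lemma commute_2_tform:
  assumes "M ** N = N ** M"
  shows "(tform M N)\<^sup>2 = tform M M * tform N N"
  using commute_2_proportional[OF assms]
  by (auto simp: tform_def matrix_matrix_mult_2 trace_2 mscale_nth algebra_simps power2_eq_square)

lemma noncommute_2_independent:
  assumes "M ** N \<noteq> N ** M"
    and "a *\<^sub>M mat 1 + b *\<^sub>M traceless M + c *\<^sub>M traceless N =
         a' *\<^sub>M mat 1 + b' *\<^sub>M traceless M + c' *\<^sub>M traceless N"
  shows "a = a'" "b = b'" "c = c'"
proof -
  have t: "traceless X $ 2 $ 2 = - traceless X $ 1 $ 1" for X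
    by (simp add: traceless_nth)
  note e = assms(2)[unfolded matrix_2_eq_iff, simplified, unfolded mscale_nth mat_2_nth t, simplified]
  \<comment> \<open>The diagonal entries of a trace-free matrix are opposite, so adding the two
    diagonal equations leaves only \<open>a\<close> and \<open>a'\<close>.\<close>
  show a: "a = a'"
    using e by algebra
  have 1: "(b - b') * traceless M $ 1 $ 1 = (c' - c) * traceless N $ 1 $ 1"
    and 2: "(b - b') * traceless M $ 1 $ 2 = (c' - c) * traceless N $ 1 $ 2"
    and 3: "(b - b') * traceless M $ 2 $ 1 = (c' - c) * traceless N $ 2 $ 1"
    using e a by algebra+
  show "b = b'"
  proof (rule ccontr)
    assume "b \<noteq> b'"
    then have "b - b' \<noteq> 0" by simp
    \<comment> \<open>Relations \<open>1\<close>, \<open>2\<close> and \<open>3\<close> turn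
      \<open>b - b'\<close> times the coordinates of \<open>M\<close> into a multiple of those of
      \<open>N\<close>, so every minor vanishes and the matrices would commute.\<close>
    have "(b - b') * (traceless M $ 1 $ 1 * traceless N $ 1 $ 2 - traceless M $ 1 $ 2 * traceless N $ 1 $ 1) = 0"
      "(b - b') * (traceless M $ 1 $ 1 * traceless N $ 2 $ 1 - traceless M $ 2 $ 1 * traceless N $ 1 $ 1) = 0"
      "(b - b') * (traceless M $ 1 $ 2 * traceless N $ 2 $ 1 - traceless M $ 2 $ 1 * traceless N $ 1 $ 2) = 0"
      using 1 2 3 by algebra+
    with \<open>b - b' \<noteq> 0\<close> assms(1) show False
      unfolding commute_2_iff by simp
  qed
  show "c = c'"
  proof (rule ccontr)
    assume "c \<noteq> c'"
    then have "c' - c \<noteq> 0" by simp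
    have "(c' - c) * (traceless M $ 1 $ 1 * traceless N $ 1 $ 2 - traceless M $ 1 $ 2 * traceless N $ 1 $ 1) = 0"
      "(c' - c) * (traceless M $ 1 $ 1 * traceless N $ 2 $ 1 - traceless M $ 2 $ 1 * traceless N $ 1 $ 1) = 0"
      "(c' - c) * (traceless M $ 1 $ 2 * traceless N $ 2 $ 1 - traceless M $ 2 $ 1 * traceless N $ 1 $ 2) = 0"
      using 1 2 3 by algebra+
    with \<open>c' - c \<noteq> 0\<close> assms(1) show False
      unfolding commute_2_iff by simp
  qed
qed

section \<open>The exponential of a sum\<close>

lemma mscale_mult: "(a *\<^sub>M M) ** (b *\<^sub>M N) = (a * b) *\<^sub>M (M ** N)" for M N :: "complex^2^2"
  by (simp add: matrix_2_eq_iff matrix_matrix_mult_2 mscale_nth algebra_simps)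

lemma mscale_cancel: "a \<noteq> 0 \<Longrightarrow> a *\<^sub>M M = a *\<^sub>M N \<longleftrightarrow> M = N" for M N :: "complex^2^2"
  by (simp add: matrix_2_eq_iff mscale_nth)

text \<open>If s^2 = \<open>tform M M\<close>, this is the exponential of the trace-free part, of
  determinant 1. The root \<open>s\<close> is a parameter so that its sign can be chosen to
  suit.\<close>

definition unimodular_exp :: "complex \<Rightarrow> complex^2^2 \<Rightarrow> complex^2^2" where
  "unimodular_exp s M = cosh s *\<^sub>M mat 1 + shc s *\<^sub>M traceless M"

lemma matexp_unimodular:
  assumes "tform M M = s\<^sup>2"
  shows "matexp M = exp (trace M / 2) *\<^sub>M unimodular_exp s M"
  by (simp add: matexp_2[OF assms] unimodular_exp_def matrix_2_eq_iff mscale_nth algebra_simps)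

text \<open>Traces add, so the scalar factors on both sides agree; being nonzero, they
  cancel.\<close>

lemma matexp_add_iff:
  fixes M N :: "complex^2^2"
  assumes "tform M M = s\<^sup>2" "tform N N = u\<^sup>2" "tform (M + N) (M + N) = v\<^sup>2"
  shows "matexp (M + N) = matexp M ** matexp N \<longleftrightarrow>
           unimodular_exp v (M + N) = unimodular_exp s M ** unimodular_exp u N"
    and "matexp M ** matexp N = matexp N ** matexp M \<longleftrightarrow>
           unimodular_exp s M ** unimodular_exp u N = unimodular_exp u N ** unimodular_exp s M"
proof -
  have "exp (trace (M + N) / 2) = exp (trace M / 2) * exp (trace N / 2)"
    by (simp add: trace_add_2 add_divide_distrib exp_add)
  then show "matexp (M + N) = matexp M ** matexp N \<longleftrightarrow>
           unimodular_exp v (M + N) = unimodular_exp s M ** unimodular_exp u N"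
    by (simp add: matexp_unimodular[OF assms(1)] matexp_unimodular[OF assms(2)]
        matexp_unimodular[OF assms(3)] mscale_mult mscale_cancel)
  show "matexp M ** matexp N = matexp N ** matexp M \<longleftrightarrow>
           unimodular_exp s M ** unimodular_exp u N = unimodular_exp u N ** unimodular_exp s M"
    by (simp add: matexp_unimodular[OF assms(1)] matexp_unimodular[OF assms(2)]
        mscale_mult mscale_cancel mult.commute)
qed

lemma unimodular_exp_mult:
  "unimodular_exp s M ** unimodular_exp u N =
    (cosh s * cosh u) *\<^sub>M mat 1 + (shc s * cosh u) *\<^sub>M traceless M + (cosh s * shc u) *\<^sub>M traceless N
    + (shc s * shc u) *\<^sub>M (traceless M ** traceless N)"
  by (simp add: unimodular_exp_def matrix_2_eq_iff matrix_matrix_mult_2 mscale_nth mat_2_nth algebra_simps)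

lemma mscale_0_left: "0 *\<^sub>M M = 0" for M :: "complex^2^2"
  by (simp add: matrix_2_eq_iff mscale_nth)

text \<open>Unless \<open>M\<close> is scalar, the trace-free part of \<open>N\<close> is c times
  that of \<open>M\<close>. The roots are then s, c s and (1 + c) s, and the claim reduces to the
  addition theorems for cosh and sinh.\<close>

lemma matexp_add_commuting:
  fixes M N :: "complex^2^2"
  assumes "M ** N = N ** M"
  shows "matexp (M + N) = matexp M ** matexp N"
proof (cases "traceless M = 0")
  case True
  define u where "u = csqrt (tform N N)"
  have "tform M M = 0\<^sup>2" "tform N N = u\<^sup>2" "tform (M + N) (M + N) = u\<^sup>2"
    using True by (simp_all add: u_def tform_def traceless_add trace_2)
  from matexp_add_iff(1)[OF this] show ?thesis
    using True by (simp add: unimodular_exp_def traceless_add shc_def matrix_2_eq_iff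
        matrix_matrix_mult_2 mscale_nth mat_2_nth)
next
  case False
  then obtain c where c: "traceless N = c *\<^sub>M traceless M"
    using commute_2_proportional[OF assms] by blast
  define s where "s = csqrt (tform M M)"
  have s: "tform M M = s\<^sup>2"
    by (simp add: s_def)
  have N: "tform N N = (c * s)\<^sup>2"
    unfolding power_mult_distrib s[symmetric]
    by (simp add: tform_def c trace_2 matrix_matrix_mult_2 mscale_nth power2_eq_square algebra_simps)
  have MN: "tform (M + N) (M + N) = ((1 + c) * s)\<^sup>2"
    unfolding power_mult_distrib s[symmetric]
    by (simp add: tform_def c traceless_add trace_2 matrix_matrix_mult_2 mscale_nth power2_eq_square algebra_simps)
  have sq: "traceless M ** traceless M = s\<^sup>2 *\<^sub>M mat 1"
    unfolding s[symmetric]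
    by (simp add: matrix_2_eq_iff matrix_matrix_mult_2 mscale_nth mat_2_nth traceless_nth tform_2 field_simps)
  have 1: "cosh ((1 + c) * s) = cosh s * cosh (c * s) + shc s * shc (c * s) * c * s\<^sup>2"
    unfolding distrib_right cosh_add
    by (simp flip: shc_mult add: power2_eq_square algebra_simps)
  \<comment> \<open>This is the addition theorem for sinh divided by s; at s = 0 both sides are 1 +
    c.\<close>
  have 2: "(1 + c) * shc ((1 + c) * s) = shc s * cosh (c * s) + c * (cosh s * shc (c * s))"
  proof (cases "s = 0")
    case False
    have "s * ((1 + c) * shc ((1 + c) * s)) = sinh ((1 + c) * s)"
      by (simp flip: shc_mult add: algebra_simps)
    also have "\<dots> = s * (shc s * cosh (c * s) + c * (cosh s * shc (c * s)))"
      unfolding distrib_right sinh_add by (simp flip: shc_mult add: algebra_simps)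
    finally show ?thesis
      using False by simp
  qed (simp add: shc_def)
  have "unimodular_exp ((1 + c) * s) (M + N) = cosh ((1 + c) * s) *\<^sub>M mat 1
      + ((1 + c) * shc ((1 + c) * s)) *\<^sub>M traceless M"
    by (simp add: unimodular_exp_def traceless_add c matrix_2_eq_iff mscale_nth algebra_simps)
  also have "\<dots> = (cosh s * cosh (c * s)) *\<^sub>M mat 1 + (shc s * cosh (c * s)) *\<^sub>M traceless M
      + (cosh s * shc (c * s)) *\<^sub>M (c *\<^sub>M traceless M)
      + (shc s * shc (c * s)) *\<^sub>M (c *\<^sub>M (s\<^sup>2 *\<^sub>M mat 1))"
    unfolding 1 2 by (simp add: matrix_2_eq_iff mscale_nth mat_2_nth algebra_simps)
  also have "c *\<^sub>M (s\<^sup>2 *\<^sub>M mat 1) = traceless M ** traceless N"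
    unfolding sq[symmetric] c
    by (simp add: matrix_2_eq_iff matrix_matrix_mult_2 mscale_nth algebra_simps)
  also note c[symmetric]
  also note unimodular_exp_mult[symmetric]
  finally show ?thesis
    unfolding matexp_add_iff(1)[OF s N MN] .
qed

text \<open>When the exponentials commute, only \<open>shc s * shc u\<close> times the nonzero
  commutator survives, so this factor is 0. The product then lies in the span of the independent
  matrices I, M' and N', where coefficients can be compared. Conversely, the conditions make all
  three exponentials scalar.\<close>

lemma matexp_add_noncommuting_iff:
  fixes M N :: "complex^2^2"
  assumes "M ** N \<noteq> N ** M"
    and "tform M M = s\<^sup>2" "tform N N = u\<^sup>2" "tform (M + N) (M + N) = v\<^sup>2"
  shows "matexp (M + N) = matexp M ** matexp N \<and> matexp M ** matexp N = matexp N ** matexp M \<longleftrightarrow>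
         shc s = 0 \<and> shc u = 0 \<and> shc v = 0 \<and> cosh v = cosh s * cosh u"
    (is "?L \<longleftrightarrow> ?R")
proof
  assume ?L
  then have eq: "unimodular_exp v (M + N) = unimodular_exp s M ** unimodular_exp u N"
    and com: "unimodular_exp s M ** unimodular_exp u N = unimodular_exp u N ** unimodular_exp s M"
    using matexp_add_iff[OF assms(2-4)] by auto
  let ?m = "traceless M" and ?n = "traceless N"
  have "(shc s * shc u) *\<^sub>M (?m ** ?n) = (shc s * shc u) *\<^sub>M (?n ** ?m)"
    using com unfolding unimodular_exp_mult by (simp add: algebra_simps)
  then have prod: "shc s * shc u = 0"
    using assms(1) commute_traceless_iff mscale_cancel by metis
  have "cosh v *\<^sub>M mat 1 + shc v *\<^sub>M ?m + shc v *\<^sub>M ?n =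
      (cosh s * cosh u) *\<^sub>M mat 1 + (shc s * cosh u) *\<^sub>M ?m + (cosh s * shc u) *\<^sub>M ?n"
    using eq unfolding unimodular_exp_mult prod
    by (simp add: mscale_0_left unimodular_exp_def traceless_add)
       (simp add: matrix_2_eq_iff mscale_nth algebra_simps)
  note ind = noncommute_2_independent[OF assms(1) this]
  show ?R
    \<comment> \<open>The comparison gives \<open>shc v = shc s * cosh u = cosh s * shc u\<close>.
      Since cosh is nonzero wherever \<open>shc\<close> vanishes, one zero factor in
      \<open>prod\<close> forces the others.\<close>
    using prod ind shc_eq_0_cosh[of s] shc_eq_0_cosh[of u] by auto
next
  assume ?R
  then show ?L
    unfolding matexp_add_iff[OF assms(2-4)] unimodular_exp_mult
    by (simp add: mscale_0_left unimodular_exp_def mult.commute)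
qed

section \<open>Eigenvalue lists and property L\<close>

lemma charpoly_2:
  fixes M :: "complex^2^2"
  shows "charpoly M = [:det M, - trace M, 1:]"
  by (simp add: charpoly_def det_2 trace_2 algebra_simps)

lemma order_two_linear:
  "order z ([:- a, 1:] * [:- b, 1:]) = (if a = z then 1 else 0) + (if b = z then 1 else 0)"
  for a b z :: complex
proof -
  have "order z [:- c, 1:] = (if c = z then 1 else 0)" for c
    using order_power_n_n[of c 1] by (auto intro!: order_0I)
  then show ?thesis
    by (subst order_mult) auto
qed

lemma card_fibre_2:
  fixes l :: "2 \<Rightarrow> 'a"
  shows "card {i. l i = z} = (if l 1 = z then 1 else 0) + (if l 2 = z then 1 else 0)"
proof -
  have "{i :: 2. l i = z} = (if l 1 = z then {1} else {}) \<union> (if l 2 = z then {2} else {})"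
  proof (rule set_eqI)
    fix i
    show "i \<in> {i. l i = z} \<longleftrightarrow>
        i \<in> (if l 1 = z then {1} else {}) \<union> (if l 2 = z then {2} else {})"
      using exhaust_2[of i] by auto
  qed
  then show ?thesis
    by auto
qed

text \<open>Vieta's formulas: the two sides say that the characteristic polynomial splits with roots
  \<open>l 1\<close> and \<open>l 2\<close>.\<close>

lemma lists_eigenvalues_2_iff:
  fixes M :: "complex^2^2"
  shows "lists_eigenvalues l M \<longleftrightarrow> l 1 + l 2 = trace M \<and> l 1 * l 2 = det M"
proof -
  have split: "charpoly M = [:- a, 1:] * [:- b, 1:] \<longleftrightarrow> a + b = trace M \<and> a * b = det M" for a b
    by (auto simp: charpoly_2 algebra_simps)
  show ?thesis
  proof
    assume "l 1 + l 2 = trace M \<and> l 1 * l 2 = det M"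
    then show "lists_eigenvalues l M"
      unfolding lists_eigenvalues_def split[symmetric] by (simp only: order_two_linear card_fibre_2) simp
  next
    assume L: "lists_eigenvalues l M"
    \<comment> \<open>The only candidate for the second root, given the sum of the roots.\<close>
    define b where "b = trace M - l 1"
    have "card {i. l i = l 1} = order (l 1) (charpoly M)"
      using L by (simp add: lists_eigenvalues_def)
    then have "order (l 1) (charpoly M) \<noteq> 0"
      by (simp add: card_fibre_2)
    then have "poly (charpoly M) (l 1) = 0"
      using order_root by blast
    then have "charpoly M = [:- l 1, 1:] * [:- b, 1:]"
      unfolding split b_def by (simp add: charpoly_2 algebra_simps)
    moreover have "card {i. l i = l 2} = order (l 2) (charpoly M)"
      using L by (simp add: lists_eigenvalues_def)
    \<comment> \<open>If \<open>l 1 = l 2\<close>, the fibre has two elements and forces a double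
      root; otherwise \<open>l 2\<close> is a root different from \<open>l 1\<close>.\<close>
    ultimately have "b = l 2"
      by (simp only: card_fibre_2 order_two_linear) (auto split: if_splits)
    then show "l 1 + l 2 = trace M \<and> l 1 * l 2 = det M"
      using \<open>charpoly M = _\<close>[unfolded split] by simp
  qed
qed

text \<open>With \<alpha> fixed, the hypothesis determines \<open>tform A B\<close> up to sign; the
  choice of root \<beta> absorbs that sign.\<close>

lemma tform_factor:
  assumes "(tform A B)\<^sup>2 = tform A A * tform B B" and "tform A A = \<alpha>\<^sup>2"
  obtains \<beta> where "tform B B = \<beta>\<^sup>2" "tform A B = \<alpha> * \<beta>"
proof -
  have "(tform A B)\<^sup>2 = (\<alpha> * csqrt (tform B B))\<^sup>2"
    by (simp add: assms power_mult_distrib)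
  then consider "tform A B = \<alpha> * csqrt (tform B B)" | "tform A B = \<alpha> * - csqrt (tform B B)"
    by (auto simp: power2_eq_iff)
  then show thesis
    by cases (auto intro: that[of "csqrt (tform B B)"] that[of "- csqrt (tform B B)"] simp del: csqrt_square)
qed

text \<open>The form \<open>tform\<close> at x A + y B is the squared half-difference of its
  eigenvalues. Property L makes it the square of x \<alpha> + y \<beta>, and a binary quadratic form
  is such a square exactly when its discriminant is 0.\<close>

lemma property_L_2_iff: "property_L A B \<longleftrightarrow> (tform A B)\<^sup>2 = tform A A * tform B B"
  for A B :: "complex^2^2"
proof
  assume "property_L A B"
  then obtain l m :: "2 \<Rightarrow> complex" where l: "l 1 + l 2 = trace A" "l 1 * l 2 = det A"
    and m: "m 1 + m 2 = trace B" "m 1 * m 2 = det B"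
    and lm: "\<And>x y. (x * l 1 + y * m 1) * (x * l 2 + y * m 2) = det (x *\<^sub>M A + y *\<^sub>M B)"
    unfolding property_L_def lists_eigenvalues_2_iff by blast
  define \<alpha> \<beta> where "\<alpha> = (l 1 - l 2) / 2" and "\<beta> = (m 1 - m 2) / 2"
  have "tform A A = \<alpha>\<^sup>2"
    using l unfolding \<alpha>_def tform_2 trace_2 det_2 by (simp add: field_simps power2_eq_square) algebra
  moreover have "tform B B = \<beta>\<^sup>2"
    using m unfolding \<beta>_def tform_2 trace_2 det_2 by (simp add: field_simps power2_eq_square) algebra
  \<comment> \<open>The determinant at x = y = 1 supplies the mixed coefficient.\<close>
  moreover have "tform A B = \<alpha> * \<beta>"
    using lm[of 1 1] l m unfolding \<alpha>_def \<beta>_def tform_2 trace_2 det_2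
    by (simp add: mscale_nth field_simps) algebra
  ultimately show "(tform A B)\<^sup>2 = tform A A * tform B B"
    by (simp add: power_mult_distrib)
next
  assume eq: "(tform A B)\<^sup>2 = tform A A * tform B B"
  define \<alpha> where "\<alpha> = csqrt (tform A A)"
  have \<alpha>: "tform A A = \<alpha>\<^sup>2"
    by (simp add: \<alpha>_def)
  obtain \<beta> where \<beta>: "tform B B = \<beta>\<^sup>2" "tform A B = \<alpha> * \<beta>"
    using tform_factor[OF eq \<alpha>] .
  define l m where "l = (\<lambda>i::2. trace A / 2 + (if i = 1 then \<alpha> else - \<alpha>))"
    and "m = (\<lambda>i::2. trace B / 2 + (if i = 1 then \<beta> else - \<beta>))"
  have main: "(x * l 1 + y * m 1) * (x * l 2 + y * m 2) = det (x *\<^sub>M A + y *\<^sub>M B)" for x y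
  proof -
    \<comment> \<open>The product of two numbers is the square of their mean minus the square of
      their half-difference.\<close>
    have "(x * l 1 + y * m 1) * (x * l 2 + y * m 2) =
        (x * (trace A / 2) + y * (trace B / 2))\<^sup>2 -
        (x\<^sup>2 * tform A A + 2 * x * y * tform A B + y\<^sup>2 * tform B B)"
      unfolding l_def m_def \<alpha> \<beta>
      by (simp add: algebra_simps power2_eq_square add_divide_distrib)
    also have "\<dots> = det (x *\<^sub>M A + y *\<^sub>M B)"
      by (simp add: tform_2 trace_2 det_2 mscale_nth field_simps power2_eq_square)
    finally show ?thesis .
  qed
  show "property_L A B"
    unfolding property_L_def lists_eigenvalues_2_iff
  proof (rule exI[of _ l], rule exI[of _ m], intro conjI allI)
    show "l 1 * l 2 = det A" "m 1 * m 2 = det B"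
      using main[of 1 0] main[of 0 1] by (simp_all add: det_2 mscale_nth)
  qed (use main in \<open>simp_all add: l_def m_def trace_2 mscale_nth algebra_simps flip: add_divide_distrib\<close>)
qed

section \<open>Integer quadratic polynomials with square values\<close>

text \<open>Completing the square after multiplying by 4 k^2 leaves two squares with the constant
  difference 4 k^2 l^2 - N^2. Squares of large integers cannot differ by a fixed nonzero
  number.\<close>

lemma quadratic_square_values:
  fixes k l N :: int
  assumes "k \<noteq> 0" and "\<And>t::nat. t \<ge> t\<^sub>0 \<Longrightarrow> \<exists>m. k\<^sup>2 * (int t)\<^sup>2 + N * int t + l\<^sup>2 = m\<^sup>2"
  shows "N\<^sup>2 = 4 * k\<^sup>2 * l\<^sup>2"
proof (rule ccontr)
  assume neq: "N\<^sup>2 \<noteq> 4 * k\<^sup>2 * l\<^sup>2"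
  define D where "D = 4 * k\<^sup>2 * l\<^sup>2 - N\<^sup>2"
  \<comment> \<open>Large enough that |2 k^2 t + N| is at least 2 t - |N|, hence exceeds
    |D|.\<close>
  define t where "t = max t\<^sub>0 (nat (\<bar>N\<bar> + \<bar>D\<bar> + 1))"
  obtain m where m: "k\<^sup>2 * (int t)\<^sup>2 + N * int t + l\<^sup>2 = m\<^sup>2"
    using assms(2)[of t] by (auto simp: t_def)
  define x y where "x = 2 * k * m" and "y = 2 * k\<^sup>2 * int t + N"
  \<comment> \<open>A nonzero difference of the squares of x and y is at least |x| + |y|, which grows with t.\<close>
  have "x\<^sup>2 - y\<^sup>2 = D"
    unfolding x_def y_def D_def using m by algebra
  then have D: "(\<bar>x\<bar> + \<bar>y\<bar>) * (\<bar>x\<bar> - \<bar>y\<bar>) = D"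
    by (simp add: algebra_simps power2_eq_square)
  have "D \<noteq> 0"
    using neq by (simp add: D_def)
  with D have "\<bar>x\<bar> + \<bar>y\<bar> \<le> \<bar>D\<bar>"
    by (metis dvdI dvd_imp_le_int abs_abs abs_add_abs)
  moreover have "1 * int t \<le> k\<^sup>2 * int t"
    using assms(1) by (intro mult_right_mono) (auto simp: int_one_le_iff_zero_less)
  moreover have "int t \<ge> \<bar>N\<bar> + \<bar>D\<bar> + 1"
    by (simp add: t_def)
  ultimately show False
    unfolding y_def by linarith
qed

section \<open>The two implications between the exponential equations and property L\<close>

lemma mscale_commute_iff:
  fixes A B :: "complex^2^2"
  assumes "t \<noteq> 0"
  shows "(t *\<^sub>M A) ** B = B ** (t *\<^sub>M A) \<longleftrightarrow> A ** B = B ** A"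
  using mscale_mult[of t A 1 B] mscale_mult[of 1 B t A] mscale_cancel[OF assms, of "A ** B" "B ** A"]
  by (simp add: mscale_def)

lemma property_L_of_matexp_add:
  fixes A B :: "complex^2^2"
  assumes eq: "\<And>t::nat. t = 1 \<or> t \<ge> t\<^sub>0 \<Longrightarrow>
               matexp (of_nat t *\<^sub>M A + B) = matexp (of_nat t *\<^sub>M A) ** matexp B \<and>
               matexp (of_nat t *\<^sub>M A) ** matexp B = matexp B ** matexp (of_nat t *\<^sub>M A)"
  shows "property_L A B"
proof (cases "A ** B = B ** A")
  case True
  then show ?thesis
    unfolding property_L_2_iff by (rule commute_2_tform)
next
  case False
  define \<alpha> \<beta> where "\<alpha> = csqrt (tform A A)" and "\<beta> = csqrt (tform B B)"
  have \<alpha>: "tform A A = \<alpha>\<^sup>2" and \<beta>: "tform B B = \<beta>\<^sup>2"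
    by (simp_all add: \<alpha>_def \<beta>_def)
  \<comment> \<open>The bound 1 keeps t nonzero, so that t A still fails to commute with B.\<close>
  have *: "shc (of_nat t * \<alpha>) = 0 \<and> shc \<beta> = 0 \<and>
      (\<exists>m::int. of_nat t ^ 2 * \<alpha>\<^sup>2 + 2 * of_nat t * tform A B + \<beta>\<^sup>2 = - (of_real pi)\<^sup>2 * (of_int m)\<^sup>2)"
    if t: "t = 1 \<or> t \<ge> max t\<^sub>0 1" for t :: nat
  proof -
    define v where "v = csqrt (tform (of_nat t *\<^sub>M A + B) (of_nat t *\<^sub>M A + B))"
    have v: "tform (of_nat t *\<^sub>M A + B) (of_nat t *\<^sub>M A + B) = v\<^sup>2"
      by (simp add: v_def)
    have A: "tform (of_nat t *\<^sub>M A) (of_nat t *\<^sub>M A) = (of_nat t * \<alpha>)\<^sup>2"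
      by (simp add: tform_scale \<alpha> power_mult_distrib)
    have "(of_nat t *\<^sub>M A) ** B \<noteq> B ** (of_nat t *\<^sub>M A)"
      using False t by (subst mscale_commute_iff) auto
    note iff = matexp_add_noncommuting_iff[OF this A \<beta> v]
    have *: "shc (of_nat t * \<alpha>) = 0 \<and> shc \<beta> = 0 \<and> shc v = 0"
      using eq[of t] t iff by auto
    then obtain m :: int where "v = of_real (pi * of_int m) * \<i>"
      using shc_eq_0_iff by blast
    then have "v\<^sup>2 = - (of_real pi)\<^sup>2 * (of_int m)\<^sup>2"
      by (simp add: power_mult_distrib)
    with * v show ?thesis
      unfolding tform_scale_add \<alpha> \<beta> by auto
  qed
  obtain m\<^sub>1 :: int where "shc \<alpha> = 0" "shc \<beta> = 0"
      and m\<^sub>1: "\<alpha>\<^sup>2 + 2 * tform A B + \<beta>\<^sup>2 = - (of_real pi)\<^sup>2 * (of_int m\<^sub>1)\<^sup>2"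
    using *[of 1] by auto
  then obtain k l :: int where k: "k \<noteq> 0" "\<alpha> = of_real (pi * of_int k) * \<i>"
      and l: "\<beta> = of_real (pi * of_int l) * \<i>"
    unfolding shc_eq_0_iff by blast
  have k2: "\<alpha>\<^sup>2 = - (of_real pi)\<^sup>2 * (of_int k)\<^sup>2" and l2: "\<beta>\<^sup>2 = - (of_real pi)\<^sup>2 * (of_int l)\<^sup>2"
    unfolding k l by (simp_all add: power_mult_distrib)
  \<comment> \<open>The equation at t = 1 is what makes the middle coefficient an integer.\<close>
  define N where "N = m\<^sub>1\<^sup>2 - k\<^sup>2 - l\<^sup>2"
  have N: "2 * tform A B = - (of_real pi)\<^sup>2 * of_int N"
    using m\<^sub>1 unfolding k2 l2 N_def by (simp add: algebra_simps)
  have "N\<^sup>2 = 4 * k\<^sup>2 * l\<^sup>2"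
  proof (rule quadratic_square_values[OF k(1), of "max t\<^sub>0 1"])
    fix t :: nat
    assume "t \<ge> max t\<^sub>0 1"
    then obtain m :: int where
      "of_nat t ^ 2 * \<alpha>\<^sup>2 + 2 * of_nat t * tform A B + \<beta>\<^sup>2 = - (of_real pi)\<^sup>2 * (of_int m)\<^sup>2"
      using *[of t] by blast
    then have "(of_real pi)\<^sup>2 * of_int (k\<^sup>2 * (int t)\<^sup>2 + N * int t + l\<^sup>2) = (of_real pi)\<^sup>2 * (of_int (m\<^sup>2) :: complex)"
      using N unfolding k2 l2 of_int_add of_int_mult of_int_power of_int_of_nat_eq by algebra
    then have "k\<^sup>2 * (int t)\<^sup>2 + N * int t + l\<^sup>2 = m\<^sup>2"
      unfolding mult_cancel_left of_int_eq_iff by simp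
    then show "\<exists>m. k\<^sup>2 * (int t)\<^sup>2 + N * int t + l\<^sup>2 = m\<^sup>2" ..
  qed
  then have "(of_int N)\<^sup>2 = (4 * (of_int k)\<^sup>2 * (of_int l)\<^sup>2 :: complex)"
    by (metis of_int_mult of_int_numeral of_int_power)
  with N show ?thesis
    unfolding property_L_2_iff \<alpha> \<beta> k2 l2 by algebra
qed

text \<open>In the noncommuting case property L makes the root for t A + B linear in t, namely i pi
  (t k + l). The equations can then fail only where this root is 0, since \<open>shc 0\<close> is
  1.\<close>

lemma matexp_add_of_property_L:
  fixes A B :: "complex^2^2"
  assumes "property_L A B"
    and eq: "matexp (A + B) = matexp A ** matexp B" "matexp A ** matexp B = matexp B ** matexp A"
  obtains U where "finite U" "U \<subseteq> {n. n \<ge> 2}"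
    "\<And>t. t \<ge> 1 \<Longrightarrow> t \<notin> U \<Longrightarrow>
       matexp (of_nat t *\<^sub>M A + B) = matexp (of_nat t *\<^sub>M A) ** matexp B \<and>
       matexp (of_nat t *\<^sub>M A) ** matexp B = matexp B ** matexp (of_nat t *\<^sub>M A)"
proof (cases "A ** B = B ** A")
  case True
  have "matexp (of_nat t *\<^sub>M A + B) = matexp (of_nat t *\<^sub>M A) ** matexp B \<and>
       matexp (of_nat t *\<^sub>M A) ** matexp B = matexp B ** matexp (of_nat t *\<^sub>M A)"
    if "t \<ge> 1" for t :: nat
  proof -
    have "(of_nat t *\<^sub>M A) ** B = B ** (of_nat t *\<^sub>M A)"
      using True that by (subst mscale_commute_iff) auto
    then show ?thesis
      using matexp_add_commuting[of "of_nat t *\<^sub>M A" B] matexp_add_commuting[of B "of_nat t *\<^sub>M A"]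
      by (simp add: add.commute)
  qed
  then show thesis
    using that[of "{}"] by simp
next
  case False
  define \<alpha> where "\<alpha> = csqrt (tform A A)"
  have \<alpha>: "tform A A = \<alpha>\<^sup>2"
    by (simp add: \<alpha>_def)
  obtain \<beta> where \<beta>: "tform B B = \<beta>\<^sup>2" "tform A B = \<alpha> * \<beta>"
    using assms(1) tform_factor property_L_2_iff \<alpha> by metis
  have tAB: "tform (t *\<^sub>M A + B) (t *\<^sub>M A + B) = (t * \<alpha> + \<beta>)\<^sup>2" for t
    unfolding tform_scale_add \<alpha> \<beta> by (simp add: power2_eq_square algebra_simps)
  have AB: "tform (A + B) (A + B) = (\<alpha> + \<beta>)\<^sup>2"
    using tAB[of 1] by (simp add: mscale_def)
  have sh: "shc \<alpha> = 0" "shc \<beta> = 0" "shc (\<alpha> + \<beta>) = 0"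
    using matexp_add_noncommuting_iff[OF False \<alpha> \<beta>(1) AB] eq by auto
  then obtain k l :: int where k: "k \<noteq> 0" "\<alpha> = of_real (pi * of_int k) * \<i>"
      and l: "\<beta> = of_real (pi * of_int l) * \<i>"
    unfolding shc_eq_0_iff by blast
  \<comment> \<open>As k is nonzero, at most one t satisfies the equation; t = 1 is covered by the
    hypothesis \<open>eq\<close>.\<close>
  define U where "U = {t::nat. t \<ge> 2 \<and> int t * k + l = 0}"
  have "U \<subseteq> {nat (- l div k)}"
  proof
    fix t assume "t \<in> U"
    then have "- l = int t * k"
      by (simp add: U_def)
    then show "t \<in> {nat (- l div k)}"
      using k(1) by simp
  qed
  then have "finite U"
    using finite_subset by blast
  moreover have "matexp (of_nat t *\<^sub>M A + B) = matexp (of_nat t *\<^sub>M A) ** matexp B \<and>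
       matexp (of_nat t *\<^sub>M A) ** matexp B = matexp B ** matexp (of_nat t *\<^sub>M A)"
    if t: "t \<ge> 1" "t \<notin> U" for t :: nat
  proof (cases "t = 1")
    case True
    then show ?thesis
      using eq by (simp add: mscale_def)
  next
    case t1: False
    have ne: "(of_nat t *\<^sub>M A) ** B \<noteq> B ** (of_nat t *\<^sub>M A)"
      using False t by (subst mscale_commute_iff) auto
    have tA: "tform (of_nat t *\<^sub>M A) (of_nat t *\<^sub>M A) = (of_nat t * \<alpha>)\<^sup>2"
      by (simp add: tform_scale \<alpha> power_mult_distrib)
    have "of_nat t * \<alpha> = of_real (pi * of_int (int t * k)) * \<i>" "int t * k \<noteq> 0"
      using k t by auto
    then have 1: "shc (of_nat t * \<alpha>) = 0"
      unfolding shc_eq_0_iff by blast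
    have "of_nat t * \<alpha> + \<beta> = of_real (pi * of_int (int t * k + l)) * \<i>" "int t * k + l \<noteq> 0"
      using k l t t1 by (auto simp: U_def algebra_simps)
    then have 2: "shc (of_nat t * \<alpha> + \<beta>) = 0"
      unfolding shc_eq_0_iff by blast
    \<comment> \<open>The remaining cosh condition is the addition theorem, whose sinh product
      vanishes.\<close>
    show ?thesis
      unfolding matexp_add_noncommuting_iff[OF ne tA \<beta>(1) tAB]
      using 1 2 sh by (simp add: cosh_add shc_eq_0_sinh)
  qed
  ultimately show thesis
    using that[of U] by (auto simp: U_def)
qed

theorem theorem1:
  fixes A B :: "complex^2^2"
  shows "(\<exists>U::nat set. finite U \<and> U \<subseteq> {n. n \<ge> 2} \<and>
            (\<forall>t\<in>{n. n \<ge> 1} - U.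
               matexp (of_nat t *\<^sub>M A + B) = matexp (of_nat t *\<^sub>M A) ** matexp B \<and>
               matexp (of_nat t *\<^sub>M A) ** matexp B = matexp B ** matexp (of_nat t *\<^sub>M A)))
         \<longleftrightarrow>
         (matexp (A + B) = matexp A ** matexp B \<and>
          matexp A ** matexp B = matexp B ** matexp A \<and>
          property_L A B)"
    (is "(\<exists>U. finite U \<and> U \<subseteq> _ \<and> (\<forall>t\<in>_ - U. ?E t)) \<longleftrightarrow> ?R")
proof
  assume "\<exists>U. finite U \<and> U \<subseteq> {n. n \<ge> 2} \<and> (\<forall>t\<in>{n. n \<ge> 1} - U. ?E t)"
  then obtain U where U: "finite U" "U \<subseteq> {n. n \<ge> 2}" "\<forall>t\<in>{n. n \<ge> 1} - U. ?E t"
    by blast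
  have E1: "?E 1"
    using U by force
  \<comment> \<open>Inserting 0 keeps the maximum meaningful when \<open>U\<close> is empty.\<close>
  have "?E t" if "t = 1 \<or> t \<ge> Suc (Max (insert 0 U))" for t
  proof -
    have "t \<notin> U" if "t \<ge> Suc (Max (insert 0 U))"
      using that U(1) by (metis Max_ge finite_insert insertCI not_less_eq_eq)
    then show ?thesis
      using that U(3) E1 by fastforce
  qed
  then have "property_L A B"
    by (rule property_L_of_matexp_add)
  with E1 show ?R
    by (simp add: mscale_def)
next
  assume ?R
  then show "\<exists>U. finite U \<and> U \<subseteq> {n. n \<ge> 2} \<and> (\<forall>t\<in>{n. n \<ge> 1} - U. ?E t)"
    by (elim conjE) (erule (2) matexp_add_of_property_L, blast)
qed

end
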